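(* Each of the following three elements of the Racah algebra $\Re$ is a Casimir element of $\Re$: $$\Omega_A = D^2+\frac{BAC+CAB}{2}+A^2+B\gamma-C\beta-A\delta,$$ $$\Omega_B = D^2+\frac{CBA+ABC}{2}+B^2+C\alpha-A\gamma-B\delta,$$ $$\Omega_C = D^2+\frac{ACB+BCA}{2}+C^2+A\beta-B\alpha-C\delta.$$
   Context: $\mathbb F$ is a field with $\operatorname{char}\mathbb F\neq 2$. All algebras are unital and associative, and a subalgebra has the same unit as the parent algebra. Write $[x,y]=xy-yx$ and $\{x,y\}=xy+yx$. The Racah algebra $\Re$ is the $\mathbb F$-algebra defined by generators $A,B,C,D$ and the relations $[A,B]=[B,C]=[C,A]=2D$ together with the relations asserting that each of the elements $$\alpha=[A,D]+AC-BA,\qquad \beta=[B,D]+BA-CB,\qquad \gamma=[C,D]+CB-AC$$ is central in $\Re$. Set $\delta=A+B+C$. Let $\mathfrak C$ denote the $\mathbb F$-subalgebra of $\Re$ generated by $\alpha,\beta,\gamma,\delta$ (it is commutative and contained in the center of $\Re$). The Casimir class of $\Re$ is the coset $$D^2+A^2+B^2+\frac{(\delta+2)\{A,B\}-\{A^2,B\}-\{A,B^2\}}{2}+A(\beta-\delta)-B(\delta+\alpha)+\mathfrak C$$ of $\mathfrak C$ in $\Re$; each element of this coset is called a Casimir element of $\Re$. *)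

theory Defs
  imports Complex_Main "HOL-Library.Poly_Mapping" "HOL-Library.Set_Algebras"
begin

datatype gen = GA | GB | GC | GD

datatype free_word = Word "gen list"

instantiation free_word :: monoid_add
begin

definition zero_free_word :: free_word
  where "0 = Word []"

fun plus_free_word :: "free_word \<Rightarrow> free_word \<Rightarrow> free_word"
  where "Word u + Word v = Word (u @ v)"

instance
proof
  fix a b c :: free_word
  show "a + b + c = a + (b + c)" by (cases a; cases b; cases c) simp
  show "0 + a = a" by (cases a) (simp add: zero_free_word_def)
  show "a + 0 = a" by (cases a) (simp add: zero_free_word_def)
qed

end

text \<open>The monoid algebra of the free monoid, with the convolution product of
  \<^theory>\<open>HOL-Library.Poly_Mapping\<close>, is the free unital associative algebra. The monoid of words is
  written additively because that theory expects an additive monoid.\<close>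

type_synonym 'a free_alg = "free_word \<Rightarrow>\<^sub>0 'a"

definition free_gen :: "gen \<Rightarrow> 'a::field free_alg"
  where "free_gen g = Poly_Mapping.single (Word [g]) 1"

definition free_scale :: "'a::field \<Rightarrow> 'a free_alg \<Rightarrow> 'a free_alg"
  where "free_scale c p = Poly_Mapping.single 0 c * p"

lemma single_zero_central:
  "Poly_Mapping.single 0 c * p = p * Poly_Mapping.single 0 c" for p :: "'a::field free_alg"
proof (induction p rule: update_induct)
  case const
  show ?case by simp
next
  case (update p k b)
  have "Poly_Mapping.update k b p = p + Poly_Mapping.single k b"
    using update.hyps
    by (intro poly_mapping_eqI) (auto simp: lookup_update lookup_add lookup_single in_keys_iff)
  with update.IH show ?case
    by (simp add: mult_single distrib_left distrib_right mult.commute)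
qed

definition commutator :: "'r::ring \<Rightarrow> 'r \<Rightarrow> 'r"
  where "commutator x y = x * y - y * x"

definition anticommutator :: "'r::ring \<Rightarrow> 'r \<Rightarrow> 'r"
  where "anticommutator x y = x * y + y * x"

definition free_alpha :: "'a::field free_alg" where
  "free_alpha = commutator (free_gen GA) (free_gen GD)
     + free_gen GA * free_gen GC - free_gen GB * free_gen GA"

definition free_beta :: "'a::field free_alg" where
  "free_beta = commutator (free_gen GB) (free_gen GD)
     + free_gen GB * free_gen GA - free_gen GC * free_gen GB"

definition free_gamma :: "'a::field free_alg" where
  "free_gamma = commutator (free_gen GC) (free_gen GD)
     + free_gen GC * free_gen GB - free_gen GA * free_gen GC"

text \<open>The two-sided ideal generated by the defining relations. The ideal is closed under scalar
  multiplication since the scalars are themselves elements of the free algebra.\<close>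

inductive_set racah_ideal :: "'a::field free_alg set" where
  rel_AB: "commutator (free_gen GA) (free_gen GB) - 2 * free_gen GD \<in> racah_ideal"
| rel_BC: "commutator (free_gen GB) (free_gen GC) - 2 * free_gen GD \<in> racah_ideal"
| rel_CA: "commutator (free_gen GC) (free_gen GA) - 2 * free_gen GD \<in> racah_ideal"
| rel_alpha: "commutator free_alpha x \<in> racah_ideal"
| rel_beta: "commutator free_beta x \<in> racah_ideal"
| rel_gamma: "commutator free_gamma x \<in> racah_ideal"
| ideal_zero: "0 \<in> racah_ideal"
| ideal_add: "\<lbrakk>p \<in> racah_ideal; q \<in> racah_ideal\<rbrakk> \<Longrightarrow> p + q \<in> racah_ideal"
| ideal_mult_left: "p \<in> racah_ideal \<Longrightarrow> x * p \<in> racah_ideal"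
| ideal_mult_right: "p \<in> racah_ideal \<Longrightarrow> p * x \<in> racah_ideal"

lemma ideal_uminus: "p \<in> racah_ideal \<Longrightarrow> - p \<in> racah_ideal"
  using ideal_mult_left[of p "- 1"] by simp

definition racah_cong :: "'a::field free_alg \<Rightarrow> 'a free_alg \<Rightarrow> bool"
  where "racah_cong p q \<longleftrightarrow> p - q \<in> racah_ideal"

lemma equivp_racah_cong: "equivp (racah_cong :: 'a::field free_alg \<Rightarrow> _)"
proof (rule equivpI)
  show "reflp (racah_cong :: 'a free_alg \<Rightarrow> _)"
    by (auto intro: reflpI simp: racah_cong_def ideal_zero)
  show "symp (racah_cong :: 'a free_alg \<Rightarrow> _)"
  proof (rule sympI)
    fix p q :: "'a free_alg"
    assume "racah_cong p q"
    then have "- (p - q) \<in> racah_ideal" unfolding racah_cong_def by (rule ideal_uminus)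
    then show "racah_cong q p" by (simp add: racah_cong_def)
  qed
  show "transp (racah_cong :: 'a free_alg \<Rightarrow> _)"
  proof (rule transpI)
    fix p q r :: "'a free_alg"
    assume "racah_cong p q" "racah_cong q r"
    then have "(p - q) + (q - r) \<in> racah_ideal" unfolding racah_cong_def by (rule ideal_add)
    then show "racah_cong p r" by (simp add: racah_cong_def)
  qed
qed

quotient_type (overloaded) 'a racah = "'a::field free_alg" / racah_cong
  morphisms rep_racah racah_of
  by (rule equivp_racah_cong)

text \<open>The augmentation (constant coefficient) kills all relators. It shows that the quotient is not
  the zero ring, as the class \<^class>\<open>ring_1\<close> requires.\<close>

lemma lookup_mult_0: "Poly_Mapping.lookup (p * q) 0 = Poly_Mapping.lookup p 0 * Poly_Mapping.lookup q 0"
  for p q :: "'a::field free_alg"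
proof -
  have *: "0 = l + r \<longleftrightarrow> r = 0 \<and> l = 0" for l r :: free_word
    by (cases l; cases r) (auto simp: zero_free_word_def)
  have "Poly_Mapping.lookup (p * q) 0
      = Sum_any (\<lambda>l. (Poly_Mapping.lookup p l * Sum_any (\<lambda>r. Poly_Mapping.lookup q r when r = 0)) when l = 0)"
    unfolding lookup_mult
    by (rule Sum_any.cong) (auto simp: * when_def)
  then show ?thesis by simp
qed

lemma lookup_free_gen_0: "Poly_Mapping.lookup (free_gen g) 0 = 0"
  by (simp add: free_gen_def lookup_single zero_free_word_def)

lemma racah_ideal_augmentation:
  "p \<in> racah_ideal \<Longrightarrow> Poly_Mapping.lookup p 0 = 0"
  by (induction rule: racah_ideal.induct)
    (simp_all add: commutator_def lookup_minus lookup_add lookup_mult_0 lookup_free_gen_0 mult.commute)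

instantiation racah :: (field) ring_1
begin

lift_definition zero_racah :: "'a racah" is 0 .
lift_definition one_racah :: "'a racah" is 1 .

lift_definition plus_racah :: "'a racah \<Rightarrow> 'a racah \<Rightarrow> 'a racah" is "(+)"
  unfolding racah_cong_def
proof -
  fix p q r s :: "'a free_alg"
  assume "p - q \<in> racah_ideal" "r - s \<in> racah_ideal"
  then have "(p - q) + (r - s) \<in> racah_ideal" by (rule ideal_add)
  then show "p + r - (q + s) \<in> racah_ideal" by (simp add: algebra_simps)
qed

lift_definition uminus_racah :: "'a racah \<Rightarrow> 'a racah" is uminus
  unfolding racah_cong_def
proof -
  fix p q :: "'a free_alg"
  assume "p - q \<in> racah_ideal"
  then have "- (p - q) \<in> racah_ideal" by (rule ideal_uminus)
  then show "- p - - q \<in> racah_ideal" by (simp add: algebra_simps)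
qed

lift_definition minus_racah :: "'a racah \<Rightarrow> 'a racah \<Rightarrow> 'a racah" is "(-)"
  unfolding racah_cong_def
proof -
  fix p q r s :: "'a free_alg"
  assume "p - q \<in> racah_ideal" "r - s \<in> racah_ideal"
  then have "(p - q) + - (r - s) \<in> racah_ideal" by (intro ideal_add ideal_uminus)
  then show "p - r - (q - s) \<in> racah_ideal" by (simp add: algebra_simps)
qed

lift_definition times_racah :: "'a racah \<Rightarrow> 'a racah \<Rightarrow> 'a racah" is "(*)"
  unfolding racah_cong_def
proof -
  fix p q r s :: "'a free_alg"
  assume "p - q \<in> racah_ideal" "r - s \<in> racah_ideal"
  then have "(p - q) * r + q * (r - s) \<in> racah_ideal"
    by (intro ideal_add ideal_mult_left ideal_mult_right)
  then show "p * r - q * s \<in> racah_ideal" by (simp add: algebra_simps)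
qed

instance
proof
  fix a b c :: "'a racah"
  show "a + b + c = a + (b + c)" by transfer (simp add: racah_cong_def ideal_zero add.assoc)
  show "a + b = b + a" by transfer (simp add: racah_cong_def ideal_zero add.commute)
  show "0 + a = a" by transfer (simp add: racah_cong_def ideal_zero)
  show "- a + a = 0" by transfer (simp add: racah_cong_def ideal_zero)
  show "a - b = a + - b" by transfer (simp add: racah_cong_def ideal_zero)
  show "a * b * c = a * (b * c)" by transfer (simp add: racah_cong_def ideal_zero mult.assoc)
  show "1 * a = a" by transfer (simp add: racah_cong_def ideal_zero)
  show "a * 1 = a" by transfer (simp add: racah_cong_def ideal_zero)
  show "(a + b) * c = a * c + b * c"
    by transfer (simp add: racah_cong_def ideal_zero distrib_right)
  show "a * (b + c) = a * b + a * c"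
    by transfer (simp add: racah_cong_def ideal_zero distrib_left)
  show "0 \<noteq> (1 :: 'a racah)"
    by transfer (use racah_ideal_augmentation in \<open>fastforce simp: racah_cong_def lookup_minus\<close>)
qed

end

lift_definition racah_scale :: "'a::field \<Rightarrow> 'a racah \<Rightarrow> 'a racah" is free_scale
  unfolding racah_cong_def free_scale_def by (metis ideal_mult_left right_diff_distrib)

lemma vector_space_racah_scale: "vector_space racah_scale"
proof
  fix a b :: 'a and x y :: "'a racah"
  show "racah_scale a (x + y) = racah_scale a x + racah_scale a y"
    by transfer (simp add: racah_cong_def ideal_zero free_scale_def distrib_left)
  show "racah_scale (a + b) x = racah_scale a x + racah_scale b x"
    by transfer (simp add: racah_cong_def ideal_zero free_scale_def single_add distrib_right)
  show "racah_scale a (racah_scale b x) = racah_scale (a * b) x"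
    by transfer (simp add: racah_cong_def ideal_zero free_scale_def mult_single flip: mult.assoc)
  show "racah_scale 1 x = x"
    by transfer (simp add: racah_cong_def ideal_zero free_scale_def)
qed

lemma racah_scale_mult_left: "racah_scale c x * y = racah_scale c (x * y)"
  by transfer (simp add: racah_cong_def ideal_zero free_scale_def mult.assoc)

lemma racah_scale_mult_right: "x * racah_scale c y = racah_scale c (x * y)"
  by transfer (metis (no_types, opaque_lifting) free_scale_def mult.assoc single_zero_central
      racah_cong_def ideal_zero diff_self)

lift_definition RA :: "'a::field racah" is "free_gen GA" .
lift_definition RB :: "'a::field racah" is "free_gen GB" .
lift_definition RC :: "'a::field racah" is "free_gen GC" .
lift_definition RD :: "'a::field racah" is "free_gen GD" .

definition R\<alpha> :: "'a::field racah"
  where "R\<alpha> = commutator RA RD + RA * RC - RB * RA"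

definition R\<beta> :: "'a::field racah"
  where "R\<beta> = commutator RB RD + RB * RA - RC * RB"

definition R\<gamma> :: "'a::field racah"
  where "R\<gamma> = commutator RC RD + RC * RB - RA * RC"

definition R\<delta> :: "'a::field racah"
  where "R\<delta> = RA + RB + RC"

lemma racah_of_numeral: "racah_of (numeral n) = numeral n"
  by (induction n)
    (simp_all only: numeral.simps one_racah.abs_eq[symmetric] plus_racah.abs_eq[symmetric])

lemma racah_relations:
  "commutator RA RB = 2 * RD" "commutator RB RC = 2 * RD" "commutator RC RA = 2 * RD"
  by (simp_all add: commutator_def RA_def RB_def RC_def RD_def times_racah.abs_eq
      minus_racah.abs_eq racah.abs_eq_iff racah_cong_def
      racah_ideal.intros(1-3)[unfolded commutator_def] flip: racah_of_numeral)

lemma racah_of_alpha: "racah_of free_alpha = R\<alpha>"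
  and racah_of_beta: "racah_of free_beta = R\<beta>"
  and racah_of_gamma: "racah_of free_gamma = R\<gamma>"
  by (simp_all add: free_alpha_def free_beta_def free_gamma_def R\<alpha>_def R\<beta>_def R\<gamma>_def
      commutator_def RA_def RB_def RC_def RD_def times_racah.abs_eq minus_racah.abs_eq
      plus_racah.abs_eq)

lemma racah_central: "R\<alpha> * x = x * R\<alpha>" "R\<beta> * x = x * R\<beta>" "R\<gamma> * x = x * R\<gamma>"
proof -
  obtain p where x: "x = racah_of p" by (induct x rule: racah.abs_induct) blast
  show "R\<alpha> * x = x * R\<alpha>" "R\<beta> * x = x * R\<beta>" "R\<gamma> * x = x * R\<gamma>"
    unfolding x racah_of_alpha[symmetric] racah_of_beta[symmetric] racah_of_gamma[symmetric]
      times_racah.abs_eq racah.abs_eq_iff racah_cong_def commutator_def[symmetric]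
    by (rule rel_alpha rel_beta rel_gamma)+
qed

inductive_set racah_subalgebra :: "'a::field racah set \<Rightarrow> 'a racah set" for S where
  subalgebra_base: "x \<in> S \<Longrightarrow> x \<in> racah_subalgebra S"
| subalgebra_one: "1 \<in> racah_subalgebra S"
| subalgebra_add: "\<lbrakk>x \<in> racah_subalgebra S; y \<in> racah_subalgebra S\<rbrakk> \<Longrightarrow> x + y \<in> racah_subalgebra S"
| subalgebra_mult: "\<lbrakk>x \<in> racah_subalgebra S; y \<in> racah_subalgebra S\<rbrakk> \<Longrightarrow> x * y \<in> racah_subalgebra S"
| subalgebra_scale: "x \<in> racah_subalgebra S \<Longrightarrow> racah_scale c x \<in> racah_subalgebra S"

definition racah_\<CC> :: "'a::field racah set"
  where "racah_\<CC> = racah_subalgebra {R\<alpha>, R\<beta>, R\<gamma>, R\<delta>}"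

definition casimir_class :: "'a::field racah set" where
  "casimir_class =
     (RD^2 + RA^2 + RB^2
      + racah_scale (1/2)
          ((R\<delta> + 2) * anticommutator RA RB - anticommutator (RA^2) RB - anticommutator RA (RB^2))
      + RA * (R\<beta> - R\<delta>) - RB * (R\<delta> + R\<alpha>)) +o racah_\<CC>"

definition is_casimir :: "'a::field racah \<Rightarrow> bool"
  where "is_casimir x \<longleftrightarrow> x \<in> casimir_class"

definition \<Omega>\<^sub>A :: "'a::field racah" where
  "\<Omega>\<^sub>A = RD^2 + racah_scale (1/2) (RB * RA * RC + RC * RA * RB) + RA^2
        + RB * R\<gamma> - RC * R\<beta> - RA * R\<delta>"

definition \<Omega>\<^sub>B :: "'a::field racah" where
  "\<Omega>\<^sub>B = RD^2 + racah_scale (1/2) (RC * RB * RA + RA * RB * RC) + RB^2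
        + RC * R\<alpha> - RA * R\<gamma> - RB * R\<delta>"

definition \<Omega>\<^sub>C :: "'a::field racah" where
  "\<Omega>\<^sub>C = RD^2 + racah_scale (1/2) (RA * RC * RB + RB * RC * RA) + RC^2
        + RA * R\<beta> - RB * R\<alpha> - RC * R\<delta>"

end

theory Submission
  imports Defs
begin

text \<open>Put \<open>K\<close> for the representative of the Casimir class. Eliminating \<open>C = \<delta> - A - B\<close>
  gives \<open>\<Omega>\<^sub>C = K\<close>. In the cubic part of \<open>\<Omega>\<^sub>A\<close> the double commutator
  \<open>[[A, B], B] = 2 [D, B]\<close> appears; the definition of \<open>\<beta>\<close> and \<open>\<alpha> + \<beta> + \<gamma> = 0\<close>
  turn the result into \<open>\<Omega>\<^sub>A = K - (\<delta> \<beta> + \<beta>)\<close>. In the same way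
  \<open>[A, [A, B]] = 2 [A, D]\<close> leads to \<open>\<Omega>\<^sub>B = K + (\<delta> \<alpha> + \<alpha>)\<close>.\<close>

interpretation racah: vector_space racah_scale
  by (rule vector_space_racah_scale)

lemma two_neq_zero_if_CHAR_neq_2:
  assumes "CHAR('a::field) \<noteq> 2"
  shows "(2::'a) \<noteq> 0"
proof
  assume "(2::'a) = 0"
  then have "CHAR('a) dvd 2"
    using of_nat_eq_0_iff_char_dvd[of 2, where 'a = 'a] by simp
  then have "CHAR('a) = 1"
    using assms dvd_imp_le[of "CHAR('a)" 2] CHAR_not_1'[where 'a = 'a]
    by (cases "CHAR('a)") auto
  then show False
    using CHAR_not_1'[where 'a = 'a] by simp
qed

text \<open>Links the scalar \<open>1/2\<close> with the ring numeral \<open>2\<close>, so that the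
  halved cubic parts can be cleared and a factor \<open>2\<close> can be cancelled.\<close>

lemma racah_scale_half:
  assumes "(2::'a::field) \<noteq> 0"
  shows "racah_scale (1/2 :: 'a) (2 * x) = x"
proof -
  have "racah_scale (1/2 :: 'a) (2 * x) = racah_scale (1/2 + 1/2) x"
    by (simp only: mult_2 racah.scale_right_distrib racah.scale_left_distrib)
  also have "(1/2 + 1/2 :: 'a) = 1"
    using assms by (simp add: add_divide_distrib[symmetric])
  finally show ?thesis by simp
qed

lemma racah_subalgebra_uminus:
  "x \<in> racah_subalgebra S \<Longrightarrow> - x \<in> racah_subalgebra S"
  using subalgebra_scale[of x S "- 1"] by simp

lemma racah_subalgebra_zero: "0 \<in> racah_subalgebra S"
  using subalgebra_scale[OF subalgebra_one, where c = 0] by simp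

text \<open>Since the three commutators in the relations agree, [\<delta>, A] = [C, A] - [A, B] = 0
  and [\<delta>, B] = [A, B] - [B, C] = 0.\<close>

lemma R\<delta>_commutes:
  "R\<delta> * RA = RA * (R\<delta> :: 'a::field racah)" "R\<delta> * RB = RB * (R\<delta> :: 'a racah)"
proof -
  have "commutator RC RA = commutator RA (RB :: 'a racah)"
    and "commutator RB RC = commutator RA (RB :: 'a racah)"
    by (simp_all add: racah_relations)
  then have "RC * RA = RA * RC + (RA * RB - RB * (RA :: 'a racah))"
    and "RC * RB = RB * RC - (RA * RB - RB * (RA :: 'a racah))"
    by (simp_all add: commutator_def algebra_simps)
  then show "R\<delta> * RA = RA * (R\<delta> :: 'a racah)" "R\<delta> * RB = RB * (R\<delta> :: 'a racah)"
    by (simp_all add: R\<delta>_def algebra_simps)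
qed

text \<open>The quadratic terms telescope, which leaves [\<delta>, D]. This vanishes because
  \<delta> commutes with 2D = [A, B] and 2 can be cancelled.\<close>

lemma R\<alpha>_R\<beta>_R\<gamma>_sum:
  assumes "(2::'a::field) \<noteq> 0"
  shows "R\<alpha> + R\<beta> + R\<gamma> = (0 :: 'a racah)"
proof -
  have comm: "R\<delta> * (RA * RB) = RA * RB * R\<delta>" "R\<delta> * (RB * RA) = RB * RA * (R\<delta> :: 'a racah)"
    by (metis R\<delta>_commutes mult.assoc)+
  have D: "2 * RD = RA * RB - RB * (RA :: 'a racah)"
    unfolding racah_relations(1)[symmetric] commutator_def ..
  have "2 * commutator R\<delta> (RD :: 'a racah) = commutator R\<delta> (2 * RD)"
    by (simp add: commutator_def mult_2 algebra_simps)
  also have "\<dots> = 0"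
    unfolding D by (simp add: commutator_def left_diff_distrib right_diff_distrib comm)
  finally have "commutator R\<delta> (RD :: 'a racah) = 0"
    using racah_scale_half[OF assms, of "commutator R\<delta> RD"] by simp
  moreover have "R\<alpha> + R\<beta> + R\<gamma> = commutator R\<delta> (RD :: 'a racah)"
    by (simp add: R\<alpha>_def R\<beta>_def R\<gamma>_def R\<delta>_def commutator_def algebra_simps)
  ultimately show ?thesis by simp
qed

text \<open>Kept as a folded constant so that \<open>racah_scale (1/2)\<close> can be split around
  it without expanding it.\<close>

definition casimir_cubic :: "'a::field racah" where
  "casimir_cubic =
     (R\<delta> + 2) * anticommutator RA RB - anticommutator (RA^2) RB - anticommutator RA (RB^2)"

definition casimir_rep :: "'a::field racah" where
  "casimir_rep = RD^2 + RA^2 + RB^2 + racah_scale (1/2) casimir_cubic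
      + RA * (R\<beta> - R\<delta>) - RB * (R\<delta> + R\<alpha>)"

lemma is_casimir_iff: "is_casimir x \<longleftrightarrow> x - casimir_rep \<in> racah_\<CC>"
  unfolding is_casimir_def casimir_class_def elt_set_plus_def
    casimir_cubic_def[symmetric] casimir_rep_def[symmetric]
  by (auto simp: algebra_simps intro: bexI[of _ "x - casimir_rep"])

lemma RC_eq: "RC = R\<delta> - RA - RB"
  by (simp add: R\<delta>_def algebra_simps)

text \<open>The correction is written as a multiple of 2, ready for \<open>racah_scale_half\<close>.
  Substituting for C gives the term - 2BAB in place of - {A, B^2}; the two differ by [[A, B], B] =
  AB^2 - 2BAB + B^2A.\<close>

lemma cubic_A:
  "RB * RA * RC + RC * RA * RB
    = casimir_cubic + 2 * (commutator RD RB - anticommutator RA RB)"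
proof -
  have D: "2 * commutator RD RB = commutator (commutator RA RB) RB"
    unfolding racah_relations by (simp add: commutator_def mult_2 algebra_simps)
  \<comment> \<open>Simplification does not reorder noncommutative products, so \<delta> is moved to
    the front by hand.\<close>
  have "RB * (RA * R\<delta>) = R\<delta> * (RB * RA)"
    by (metis R\<delta>_commutes mult.assoc)
  then show ?thesis
    unfolding RC_eq right_diff_distrib[of 2] D casimir_cubic_def
    by (simp add: commutator_def anticommutator_def power2_eq_square mult_2 algebra_simps)
qed

lemma cubic_B:
  "RC * RB * RA + RA * RB * RC
    = casimir_cubic + 2 * (commutator RA RD - anticommutator RA RB)"
proof -
  have D: "2 * commutator RA RD = commutator RA (commutator RA RB)"
    unfolding racah_relations by (simp add: commutator_def mult_2 algebra_simps)
  have "RA * (RB * R\<delta>) = R\<delta> * (RA * RB)"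
    by (metis R\<delta>_commutes mult.assoc)
  then show ?thesis
    unfolding RC_eq right_diff_distrib[of 2] D casimir_cubic_def
    by (simp add: commutator_def anticommutator_def power2_eq_square mult_2 algebra_simps)
qed

text \<open>With C in the middle, the substitution yields {A^2, B} and {A, B^2} directly, and no
  double commutator arises.\<close>

lemma cubic_C:
  "RA * RC * RB + RB * RC * RA = casimir_cubic + 2 * (- anticommutator RA (RB :: 'a::field racah))"
proof -
  have "RA * (R\<delta> * RB) = R\<delta> * (RA * (RB :: 'a racah))" "RB * (R\<delta> * RA) = R\<delta> * (RB * (RA :: 'a racah))"
    by (metis R\<delta>_commutes mult.assoc)+
  then show ?thesis
    unfolding RC_eq casimir_cubic_def
    by (simp add: anticommutator_def power2_eq_square mult_2 algebra_simps)
qed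

lemma Omega_A_eq:
  assumes "(2::'a::field) \<noteq> 0"
  shows "\<Omega>\<^sub>A = casimir_rep - (R\<delta> * R\<beta> + R\<beta> :: 'a racah)"
proof -
  have \<gamma>: "R\<gamma> = - R\<alpha> - (R\<beta> :: 'a racah)"
    using R\<alpha>_R\<beta>_R\<gamma>_sum[OF assms] by (simp add: eq_neg_iff_add_eq_0 algebra_simps)
  have "commutator RD RB = RB * RA - RC * RB - (R\<beta> :: 'a racah)"
    by (simp add: R\<beta>_def commutator_def algebra_simps)
  \<comment> \<open>Expanding \<delta>B instead of B\<delta> produces AB and CB, which cancel
    against - {A, B} and [D, B].\<close>
  moreover have "RB * R\<delta> = RA * RB + RB * RB + RC * (RB :: 'a racah)"
    unfolding R\<delta>_commutes(2)[symmetric] by (simp add: R\<delta>_def algebra_simps)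
  moreover have "R\<delta> * R\<beta> = RA * R\<beta> + RB * R\<beta> + RC * (R\<beta> :: 'a racah)"
    by (simp add: R\<delta>_def algebra_simps)
  ultimately show ?thesis
    unfolding \<Omega>\<^sub>A_def casimir_rep_def cubic_A racah.scale_right_distrib racah_scale_half[OF assms] \<gamma>
    by (simp add: anticommutator_def power2_eq_square algebra_simps)
qed

lemma Omega_B_eq:
  assumes "(2::'a::field) \<noteq> 0"
  shows "\<Omega>\<^sub>B = casimir_rep + (R\<delta> * R\<alpha> + R\<alpha> :: 'a racah)"
proof -
  have \<gamma>: "R\<gamma> = - R\<alpha> - (R\<beta> :: 'a racah)"
    using R\<alpha>_R\<beta>_R\<gamma>_sum[OF assms] by (simp add: eq_neg_iff_add_eq_0 algebra_simps)
  have "commutator RA RD = R\<alpha> - RA * RC + RB * (RA :: 'a racah)"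
    by (simp add: R\<alpha>_def commutator_def algebra_simps)
  moreover have "RA * R\<delta> = RA * RA + RA * RB + RA * (RC :: 'a racah)"
    by (simp add: R\<delta>_def algebra_simps)
  moreover have "R\<delta> * R\<alpha> = RA * R\<alpha> + RB * R\<alpha> + RC * (R\<alpha> :: 'a racah)"
    by (simp add: R\<delta>_def algebra_simps)
  ultimately show ?thesis
    unfolding \<Omega>\<^sub>B_def casimir_rep_def cubic_B racah.scale_right_distrib racah_scale_half[OF assms] \<gamma>
    by (simp add: anticommutator_def power2_eq_square algebra_simps)
qed

text \<open>The quadratic terms match because C^2 - C\<delta> = (A + B)^2 - \<delta>(A + B), and (A
  + B)^2 contributes the {A, B} that cancels the correction in \<open>cubic_C\<close>.\<close>

lemma Omega_C_eq:
  assumes "(2::'a::field) \<noteq> 0"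
  shows "\<Omega>\<^sub>C = (casimir_rep :: 'a racah)"
  unfolding \<Omega>\<^sub>C_def casimir_rep_def cubic_C racah.scale_right_distrib racah_scale_half[OF assms]
  \<comment> \<open>C is eliminated only now, as \<open>cubic_C\<close> has to match the products
    containing \<open>RC\<close> first.\<close>
  unfolding RC_eq
  by (simp add: anticommutator_def power2_eq_square algebra_simps R\<delta>_commutes)

theorem proposition6p4:
  assumes "CHAR('a::field) \<noteq> 2"
  shows "is_casimir (\<Omega>\<^sub>A :: 'a racah) \<and> is_casimir (\<Omega>\<^sub>B :: 'a racah) \<and> is_casimir (\<Omega>\<^sub>C :: 'a racah)"
proof -
  note two = two_neq_zero_if_CHAR_neq_2[OF assms]
  have gens: "R\<alpha> \<in> racah_\<CC>" "R\<beta> \<in> racah_\<CC>" "R\<delta> \<in> (racah_\<CC> :: 'a racah set)"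
    unfolding racah_\<CC>_def by (auto intro: subalgebra_base)
  have "R\<delta> * R\<beta> + R\<beta> \<in> (racah_\<CC> :: 'a racah set)" "R\<delta> * R\<alpha> + R\<alpha> \<in> (racah_\<CC> :: 'a racah set)"
    using gens unfolding racah_\<CC>_def by (blast intro: subalgebra_add subalgebra_mult)+
  moreover from this(1) have "- (R\<delta> * R\<beta> + R\<beta>) \<in> (racah_\<CC> :: 'a racah set)"
    unfolding racah_\<CC>_def by (rule racah_subalgebra_uminus)
  moreover have "0 \<in> (racah_\<CC> :: 'a racah set)"
    unfolding racah_\<CC>_def by (rule racah_subalgebra_zero)
  ultimately show ?thesis
    by (simp add: is_casimir_iff Omega_A_eq[OF two] Omega_B_eq[OF two] Omega_C_eq[OF two])
qed

end
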